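(* Let $\mathcal{H}=\mathcal{H}_1\otimes\mathcal{H}_2$ with $\mathcal{H}_1,\mathcal{H}_2$ finite-dimensional complex Hilbert spaces. Let $E$ be an entanglement measure with respect to $\mathcal{C}_{\mathcal{X}}$, and suppose $\mathcal{C}_{\rm LI}\subset\mathcal{C}_{\mathcal{X}}$. Then $E$ is a universal entanglement measure, i.e. $$E\!\left(\frac{\Lambda_{\rm LI}(\rho)}{{\rm tr}\,\Lambda_{\rm LI}(\rho)}\right)=E(\rho)\quad\text{for all } \Lambda_{\rm LI}\in\mathcal{C}_{\rm LI} \text{ and all quantum states } \rho,$$ and $E$ does not depend on the Schmidt coefficients, i.e. $E(|\psi\rangle\langle\psi|)=E(|\chi\rangle\langle\chi|)$ for any two pure states $|\psi\rangle,|\chi\rangle\in\mathcal{H}$ with the same Schmidt rank.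
   Context: A quantum state is a positive semidefinite operator on $\mathcal{H}$ of trace one. It is separable if it is a convex combination of pure product states $|a\rangle\langle a|\otimes|b\rangle\langle b|$. $\mathcal{C}_{\rm sep}$ is the set of maps $\Lambda(\rho)=\sum_i[A_i\otimes B_i]\rho[A_i\otimes B_i]^\dagger$ (finite sums), with $A_i$, $B_i$ linear operators on $\mathcal{H}_1$, $\mathcal{H}_2$. $\mathcal{C}_{\mathcal{X}}$ denotes a subset of $\mathcal{C}_{\rm sep}$ closed under composition. $\mathcal{C}_{\rm LI}$ is the group of local invertibles $\rho\mapsto[T_1\otimes T_2]\rho[T_1\otimes T_2]^\dagger$ with $T_1,T_2$ invertible. An entanglement measure with respect to $\mathcal{C}_{\mathcal{X}}$ is a function $E$ from states to $[0,\infty)$ such that (i) $E(\sigma)=0$ iff $\sigma$ is separable, and (ii) $E(\rho)\ge E(\Lambda(\rho)/{\rm tr}\,\Lambda(\rho))$ for all $\Lambda\in\mathcal{C}_{\mathcal{X}}$ and all states $\rho$ with ${\rm tr}\,\Lambda(\rho)\neq0$. It is called universal if it is invariant under all (normalized) elements of $\mathcal{C}_{\rm LI}$. A pure state (unit vector) has a Schmidt decomposition $|\Psi\rangle=\sum_{n=1}^{r(\Psi)}\lambda_n|e_n\rangle\otimes|f_n\rangle$ with Schmidt coefficients $\lambda_n>0$ and $\{|e_n\rangle\}$, $\{|f_n\rangle\}$ orthonormal; $r(\Psi)$ is the Schmidt rank (equal to the Schmidt number of the pure state). *)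

theory Defs
  imports "HOL-Analysis.Analysis"
begin

text \<open>
  The Hilbert spaces are the coordinate spaces \<open>H\<^sub>1 = complex ^ 'm\<close> and \<open>H\<^sub>2 = complex ^ 'n\<close>
  with arbitrary finite index types, their tensor product is \<open>complex ^ ('m \<times> 'n)\<close>, and
  operators are matrices. The library's inner product on \<open>complex ^ 'n\<close> is the real part of the
  Hermitian one defined here, so its \<open>norm\<close> is the Hilbert space norm.
\<close>

definition cinner :: "complex ^ 'k \<Rightarrow> complex ^ 'k \<Rightarrow> complex" where
  "cinner x y = (\<Sum>i\<in>UNIV. cnj (x $ i) * y $ i)"

definition adj :: "complex ^ 'k ^ 'l \<Rightarrow> complex ^ 'l ^ 'k" where
  "adj A = (\<chi> i j. cnj (A $ j $ i))"

definition tensor_vec :: "complex ^ 'm::finite \<Rightarrow> complex ^ 'n::finite \<Rightarrow> complex ^ ('m \<times> 'n)" where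
  "tensor_vec a b = (\<chi> p. a $ fst p * b $ snd p)"

definition tensor_op :: "complex ^ 'm::finite ^ 'm \<Rightarrow> complex ^ 'n::finite ^ 'n \<Rightarrow> complex ^ ('m \<times> 'n) ^ ('m \<times> 'n)" where
  "tensor_op A B = (\<chi> p q. A $ fst p $ fst q * B $ snd p $ snd q)"

text \<open>\<open>proj_op \<psi>\<close> is the operator \<open>|\<psi>\<rangle>\<langle>\<psi>|\<close>.\<close>

definition proj_op :: "complex ^ 'k \<Rightarrow> complex ^ 'k ^ 'k" where
  "proj_op \<psi> = (\<chi> i j. \<psi> $ i * cnj (\<psi> $ j))"

definition pos_semidef :: "complex ^ 'k ^ 'k \<Rightarrow> bool" where
  "pos_semidef A \<longleftrightarrow> (\<forall>x. cinner x (A *v x) \<in> \<real>\<^sub>\<ge>\<^sub>0)"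

definition quantum_state :: "complex ^ 'k ^ 'k \<Rightarrow> bool" where
  "quantum_state \<rho> \<longleftrightarrow> pos_semidef \<rho> \<and> trace \<rho> = 1"

definition pure_state :: "complex ^ 'k \<Rightarrow> bool" where
  "pure_state \<psi> \<longleftrightarrow> norm \<psi> = 1"

definition separable_state :: "complex ^ ('m::finite \<times> 'n::finite) ^ ('m \<times> 'n) \<Rightarrow> bool" where
  "separable_state \<rho> \<longleftrightarrow>
     \<rho> \<in> convex hull {tensor_op (proj_op a) (proj_op b) | a b. pure_state a \<and> pure_state b}"

type_synonym ('m, 'n) op_map =
  "complex ^ ('m \<times> 'n) ^ ('m \<times> 'n) \<Rightarrow> complex ^ ('m \<times> 'n) ^ ('m \<times> 'n)"

definition local_conj :: "complex ^ 'm::finite ^ 'm \<Rightarrow> complex ^ 'n::finite ^ 'n \<Rightarrow> ('m, 'n) op_map" where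
  "local_conj A B = (\<lambda>\<rho>. tensor_op A B ** \<rho> ** adj (tensor_op A B))"

definition C_sep :: "('m::finite, 'n::finite) op_map set" where
  "C_sep = {\<Lambda>. \<exists>(k::nat) A B. \<Lambda> = (\<lambda>\<rho>. \<Sum>i<k. local_conj (A i) (B i) \<rho>)}"

definition C_LI :: "('m::finite, 'n::finite) op_map set" where
  "C_LI = {local_conj S T | S T. invertible S \<and> invertible T}"

definition sep_subclass :: "('m::finite, 'n::finite) op_map set \<Rightarrow> bool" where
  "sep_subclass C \<longleftrightarrow> C \<subseteq> C_sep \<and> (\<forall>\<Lambda>\<in>C. \<forall>\<Gamma>\<in>C. \<Lambda> \<circ> \<Gamma> \<in> C)"

definition normalize_op :: "complex ^ 'k ^ 'k \<Rightarrow> complex ^ 'k ^ 'k" where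
  "normalize_op A = (\<chi> i j. A $ i $ j / trace A)"

text \<open>
  A function from states to \<open>[0,\<infinity>)\<close> is a real-valued function on all operators, of which
  only the values on states are constrained and used.
\<close>

definition entanglement_measure ::
  "('m::finite, 'n::finite) op_map set \<Rightarrow> (complex ^ ('m \<times> 'n) ^ ('m \<times> 'n) \<Rightarrow> real) \<Rightarrow> bool" where
  "entanglement_measure C E \<longleftrightarrow>
     (\<forall>\<rho>. quantum_state \<rho> \<longrightarrow> 0 \<le> E \<rho>) \<and>
     (\<forall>\<sigma>. quantum_state \<sigma> \<longrightarrow> (E \<sigma> = 0 \<longleftrightarrow> separable_state \<sigma>)) \<and>
     (\<forall>\<Lambda>\<in>C. \<forall>\<rho>. quantum_state \<rho> \<longrightarrow> trace (\<Lambda> \<rho>) \<noteq> 0 \<longrightarrow> E (normalize_op (\<Lambda> \<rho>)) \<le> E \<rho>)"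

definition universal_entanglement_measure ::
  "('m::finite, 'n::finite) op_map set \<Rightarrow> (complex ^ ('m \<times> 'n) ^ ('m \<times> 'n) \<Rightarrow> real) \<Rightarrow> bool" where
  "universal_entanglement_measure C E \<longleftrightarrow>
     entanglement_measure C E \<and>
     (\<forall>\<Lambda>\<in>C_LI. \<forall>\<rho>. quantum_state \<rho> \<longrightarrow> E (normalize_op (\<Lambda> \<rho>)) = E \<rho>)"

definition orthonormal_family :: "nat \<Rightarrow> (nat \<Rightarrow> complex ^ 'k) \<Rightarrow> bool" where
  "orthonormal_family r e \<longleftrightarrow> (\<forall>i<r. \<forall>j<r. cinner (e i) (e j) = (if i = j then 1 else 0))"

definition schmidt_decomposition ::
  "complex ^ ('m::finite \<times> 'n::finite) \<Rightarrow> nat \<Rightarrow> (nat \<Rightarrow> real) \<Rightarrow> (nat \<Rightarrow> complex ^ 'm) \<Rightarrow> (nat \<Rightarrow> complex ^ 'n) \<Rightarrow> bool" where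
  "schmidt_decomposition \<psi> r l e f \<longleftrightarrow>
     (\<forall>i<r. 0 < l i) \<and> orthonormal_family r e \<and> orthonormal_family r f \<and>
     \<psi> = (\<Sum>i<r. l i *\<^sub>R tensor_vec (e i) (f i))"

definition schmidt_rank :: "complex ^ ('m::finite \<times> 'n::finite) \<Rightarrow> nat" where
  "schmidt_rank \<psi> = (THE r. \<exists>l e f. schmidt_decomposition \<psi> r l e f)"

end

theory Submission
  imports Defs
begin

text \<open>
  A local invertible map is undone, up to a scalar, by another one, and it never annihilates a
  state, because a positive semidefinite operator of trace zero vanishes. Monotonicity in both
  directions then gives invariance. For pure states of equal Schmidt rank, invertible operators
  carrying one pair of Schmidt bases to the other, and rescaling the coefficients on one side,
  form a local invertible map taking the first state to the second.

  That the Schmidt rank is well defined is part of the claim. A decomposition is found greedily,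
  by maximising the overlap of the remainder with product vectors; its length is the dimension of
  the range of the antilinear map \<open>y \<mapsto> \<langle>y|\<psi>\<rangle>\<close> from \<open>H\<^sub>2\<close> to \<open>H\<^sub>1\<close>.
\<close>

section \<open>Hermitian inner product, adjoints and tensor products of operators\<close>

lemma cinner_scale_right: "cinner x (c *s y) = c * cinner x y"
  by (simp add: cinner_def sum_distrib_left algebra_simps)

lemma cinner_scale_left: "cinner (c *s x) y = cnj c * cinner x y"
  by (simp add: cinner_def sum_distrib_left algebra_simps)

lemma cinner_sum_right: "cinner x (sum f I) = (\<Sum>i\<in>I. cinner x (f i))"
  unfolding cinner_def sum_component sum_distrib_left by (rule sum.swap)

lemma cnj_cinner: "cnj (cinner x y) = cinner y x"
  by (simp add: cinner_def mult.commute)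

lemma cinner_self: "cinner x x = complex_of_real ((norm x)\<^sup>2)"
  by (simp add: cinner_def norm_vec_def L2_set_def sum_nonneg mult.commute[of "cnj _"]
      flip: complex_norm_square)

lemma cinner_adj: "cinner x (A *v y) = cinner (adj A *v x) y"
proof -
  have "cinner x (A *v y) = (\<Sum>i\<in>UNIV. \<Sum>j\<in>UNIV. cnj (x$i) * A$i$j * y$j)"
    by (simp add: cinner_def matrix_vector_mult_def sum_distrib_left mult.assoc)
  also have "\<dots> = (\<Sum>j\<in>UNIV. \<Sum>i\<in>UNIV. cnj (x$i) * A$i$j * y$j)"
    by (rule sum.swap)
  also have "\<dots> = cinner (adj A *v x) y"
    by (simp add: cinner_def matrix_vector_mult_def adj_def sum_distrib_right
        mult.commute[of "cnj (x $ _)"])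
  finally show ?thesis .
qed

lemma adj_mult: "adj (A ** B) = adj B ** adj A"
  by (simp add: adj_def matrix_matrix_mult_def vec_eq_iff mult.commute)

lemma adj_mat_1: "adj (mat 1) = mat 1"
  by (auto simp: adj_def mat_def vec_eq_iff)

lemma sum_prod_UNIV:
  "(\<Sum>p\<in>(UNIV :: ('m::finite \<times> 'n::finite) set). f p) = (\<Sum>i\<in>UNIV. \<Sum>j\<in>UNIV. f (i, j))"
  by (simp add: sum.cartesian_product UNIV_Times_UNIV[symmetric] del: UNIV_Times_UNIV)

lemma tensor_op_mult: "tensor_op A B ** tensor_op C D = tensor_op (A ** C) (B ** D)"
  by (simp add: tensor_op_def matrix_matrix_mult_def vec_eq_iff sum_prod_UNIV sum_product mult_ac)

lemma tensor_op_mat_1: "tensor_op (mat 1) (mat 1) = mat 1"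
  by (auto simp: tensor_op_def mat_def vec_eq_iff prod_eq_iff)

lemma tensor_op_tensor_vec: "tensor_op A B *v tensor_vec a b = tensor_vec (A *v a) (B *v b)"
  by (simp add: tensor_op_def tensor_vec_def matrix_vector_mult_def vec_eq_iff sum_prod_UNIV
      sum_product mult_ac)

text \<open>Complex scalars act on operators as scalar matrices \<open>mat c\<close>, so that
  pulling a scalar out of a product is associativity together with
  \<open>mat_commute\<close>.\<close>

lemma mat_mult_nth: "(mat c ** M) $ i $ j = c * M $ i $ j"
  by (simp add: mat_def matrix_matrix_mult_def if_distrib[of "\<lambda>x. x * _"] cong: if_cong)

lemma mult_mat_nth: "(M ** mat c) $ i $ j = c * (M :: 'a::comm_semiring_1 ^ _ ^ _) $ i $ j"
  by (simp add: mat_def matrix_matrix_mult_def if_distrib[of "\<lambda>x. _ * x"] mult.commute cong: if_cong)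

lemma mat_commute: "(M :: 'a::comm_semiring_1 ^ _ ^ _) ** mat c = mat c ** M"
  by (simp add: vec_eq_iff mat_mult_nth mult_mat_nth)

lemma trace_mat_mult: "trace (mat c ** M) = c * trace (M :: 'a::comm_semiring_1 ^ _ ^ _)"
  by (simp add: trace_def mat_mult_nth sum_distrib_left)

lemma normalize_op_eq: "normalize_op M = mat (1 / trace M) ** M"
  by (simp add: normalize_op_def vec_eq_iff mat_mult_nth)

lemma normalize_op_scale:
  assumes "trace M = 1" "c \<noteq> 0"
  shows "normalize_op (mat c ** M) = M"
  using assms by (simp add: normalize_op_def trace_mat_mult vec_eq_iff mat_mult_nth)

section \<open>Algebra of local conjugations\<close>

lemma local_conj_scale: "local_conj S T (mat c ** M) = mat c ** local_conj S T M"
  by (simp add: local_conj_def matrix_mul_assoc mat_commute)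

lemma local_conj_inverse:
  assumes "S' ** S = mat 1" "T' ** T = mat 1"
  shows "local_conj S' T' (local_conj S T M) = M"
proof -
  have 1: "tensor_op S' T' ** tensor_op S T = mat 1"
    by (simp add: tensor_op_mult assms tensor_op_mat_1)
  then have 2: "adj (tensor_op S T) ** adj (tensor_op S' T') = mat 1"
    by (metis adj_mult adj_mat_1)
  have "local_conj S' T' (local_conj S T M) =
      (tensor_op S' T' ** tensor_op S T) ** M ** (adj (tensor_op S T) ** adj (tensor_op S' T'))"
    by (simp add: local_conj_def matrix_mul_assoc)
  then show ?thesis
    by (simp only: 1 2 matrix_mul_lid matrix_mul_rid)
qed

text \<open>Reduces the action on rank-one operators to the action on vectors: each of the two
  factors of \<open>proj_op\<close> absorbs one copy of the conjugating operator.\<close>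

lemma local_conj_proj_op: "local_conj S T (proj_op \<psi>) = proj_op (tensor_op S T *v \<psi>)"
proof -
  let ?V = "tensor_op S T"
  have *: "(?V ** proj_op \<psi>) $ i $ j = (?V *v \<psi>) $ i * cnj (\<psi> $ j)" for i j
    by (simp add: matrix_matrix_mult_def matrix_vector_mult_def proj_op_def sum_distrib_right mult.assoc)
  have "(?V ** proj_op \<psi> ** adj ?V) $ i $ j = (?V *v \<psi>) $ i * cnj ((?V *v \<psi>) $ j)" for i j
    unfolding matrix_matrix_mult_def[of "_ ** _"] vec_lambda_beta *
    by (simp add: matrix_vector_mult_def adj_def sum_distrib_left mult_ac)
  then show ?thesis
    by (simp add: local_conj_def proj_op_def vec_eq_iff)
qed

section \<open>Positive semidefinite operators and states\<close>

lemma pos_semidef_local_conj: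
  assumes "pos_semidef \<rho>"
  shows "pos_semidef (local_conj S T \<rho>)"
  using assms
  by (simp add: pos_semidef_def local_conj_def cinner_adj[of _ "tensor_op S T"]
      flip: matrix_vector_mul_assoc)

lemma nonneg_Reals_sum:
  fixes f :: "'a \<Rightarrow> complex"
  shows "(\<And>i. i \<in> I \<Longrightarrow> f i \<in> \<real>\<^sub>\<ge>\<^sub>0) \<Longrightarrow> sum f I \<in> \<real>\<^sub>\<ge>\<^sub>0"
  by (simp add: complex_nonneg_Reals_iff sum_nonneg)

lemma cinner_axis_axis: "cinner (axis i a) (A *v axis j b) = cnj a * A $ i $ j * b"
  by (simp add: cinner_def matrix_vector_mult_def axis_def if_distrib[of "\<lambda>x. _ * x"]
      if_distrib[of cnj] if_distrib[of "\<lambda>x. x * _"] cong: if_cong)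

lemma pos_semidef_diagonal:
  assumes "pos_semidef A"
  shows "A $ i $ i \<in> \<real>\<^sub>\<ge>\<^sub>0"
  using assms cinner_axis_axis[of i 1 A i 1] unfolding pos_semidef_def by (metis complex_cnj_one mult_1 mult_1_right)

lemma pos_semidef_trace: "pos_semidef A \<Longrightarrow> trace A \<in> \<real>\<^sub>\<ge>\<^sub>0"
  by (simp add: trace_def nonneg_Reals_sum pos_semidef_diagonal)

text \<open>The diagonal entries are nonnegative with sum zero, so they vanish. Testing positivity
  on \<open>axis i 1 + axis j c\<close> then leaves only the off-diagonal terms, and varying
  \<open>c\<close> kills these.\<close>

lemma pos_semidef_trace_0:
  assumes psd: "pos_semidef A" and tr: "trace A = 0"
  shows "A = 0"
proof -
  have "(\<Sum>i\<in>UNIV. Re (A $ i $ i)) = 0"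
    using tr by (simp add: trace_def flip: Re_sum)
  then have "Re (A $ i $ i) = 0" for i
    using pos_semidef_diagonal[OF psd] by (simp add: complex_nonneg_Reals_iff sum_nonneg_eq_0_iff)
  then have diag: "A $ i $ i = 0" for i
    using pos_semidef_diagonal[OF psd, of i] by (simp add: complex_nonneg_Reals_iff complex_eq_iff)
  have "A $ i $ j = 0" for i j
  proof -
    have *: "A $ i $ j * c + cnj c * A $ j $ i \<in> \<real>\<^sub>\<ge>\<^sub>0" for c
    proof -
      have "cinner (axis i 1 + axis j c) (A *v (axis i 1 + axis j c)) = A $ i $ j * c + cnj c * A $ j $ i"
        using cinner_axis_axis[of i 1 A i 1] cinner_axis_axis[of i 1 A j c]
          cinner_axis_axis[of j c A i 1] cinner_axis_axis[of j c A j c]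
        by (simp add: matrix_vector_right_distrib cinner_def algebra_simps sum.distrib diag)
      then show ?thesis
        using psd by (metis pos_semidef_def)
    qed
    show ?thesis
      \<comment> \<open>Opposite values of \<open>c\<close> give opposite nonnegative numbers, hence
        zero. Thus \<open>c = 1\<close> makes the sum of the entries at \<open>(i, j)\<close> and
        \<open>(j, i)\<close> vanish, and the imaginary unit makes their difference vanish.\<close>
      using *[of 1] *[of "-1"] *[of \<i>] *[of "-\<i>"]
      by (auto simp: complex_nonneg_Reals_iff complex_eq_iff)
  qed
  then show ?thesis by (simp add: vec_eq_iff)
qed

text \<open>Being nonzero suffices here, since by \<open>pos_semidef_trace_0\<close> the divisor
  \<open>trace A\<close> is then nonzero, and it is a nonnegative real.\<close>

lemma quantum_state_normalize_op:
  assumes psd: "pos_semidef A" and nz: "A \<noteq> 0"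
  shows "quantum_state (normalize_op A)"
proof -
  have tr: "trace A \<noteq> 0" "trace A \<in> \<real>\<^sub>\<ge>\<^sub>0"
    using nz pos_semidef_trace_0[OF psd] pos_semidef_trace[OF psd] by auto
  have "cinner x (normalize_op A *v x) = (1 / trace A) * cinner x (A *v x)" for x
    by (simp add: normalize_op_def cinner_def matrix_vector_mult_def sum_distrib_left
        sum_divide_distrib mult_ac)
  then have "pos_semidef (normalize_op A)"
    using psd tr unfolding pos_semidef_def
    by (metis nonneg_Reals_divide_I nonneg_Reals_mult_I nonneg_Reals_one_I)
  moreover have "trace (normalize_op A) = 1"
    using tr by (simp add: normalize_op_eq trace_mat_mult)
  ultimately show ?thesis by (simp add: quantum_state_def)
qed

lemma quantum_state_proj_op:
  assumes "pure_state \<psi>"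
  shows "quantum_state (proj_op \<psi>)"
proof -
  have "cinner x (proj_op \<psi> *v x) \<in> \<real>\<^sub>\<ge>\<^sub>0" for x
  proof -
    have "proj_op \<psi> *v x = cinner \<psi> x *s \<psi>"
      by (simp add: proj_op_def cinner_def matrix_vector_mult_def vec_eq_iff sum_distrib_right
          sum_distrib_left mult_ac)
    \<comment> \<open>The quadratic form of a rank-one operator is a squared modulus.\<close>
    then have "cinner x (proj_op \<psi> *v x) = cinner \<psi> x * cnj (cinner \<psi> x)"
      by (simp add: cinner_scale_right cnj_cinner)
    then show ?thesis
      by (metis complex_norm_square nonneg_Reals_of_real_iff zero_le_power2)
  qed
  moreover have "trace (proj_op \<psi>) = cinner \<psi> \<psi>"
    by (simp add: trace_def proj_op_def cinner_def mult.commute)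
  ultimately show ?thesis
    using assms by (simp add: quantum_state_def pos_semidef_def cinner_self pure_state_def)
qed

section \<open>Invariance under local invertible maps\<close>

lemma entanglement_measure_LI_invariant:
  assumes E: "entanglement_measure C E" and LI: "C_LI \<subseteq> C"
    and st: "quantum_state \<rho>" and S: "invertible S" and T: "invertible T"
  shows "E (normalize_op (local_conj S T \<rho>)) = E \<rho>"
proof -
  obtain S' T' where S': "S ** S' = mat 1" "S' ** S = mat 1" and T': "T ** T' = mat 1" "T' ** T = mat 1"
    using S T unfolding invertible_def by blast
  then have "invertible S'" "invertible T'"
    by (auto simp: invertible_def)
  then have C: "local_conj S T \<in> C" "local_conj S' T' \<in> C"
    using S T LI by (auto simp: C_LI_def)
  have mono: "E (normalize_op (\<Lambda> \<sigma>)) \<le> E \<sigma>"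
    if "\<Lambda> \<in> C" "quantum_state \<sigma>" "trace (\<Lambda> \<sigma>) \<noteq> 0" for \<Lambda> \<sigma>
    using E that unfolding entanglement_measure_def by blast
  let ?\<sigma> = "local_conj S T \<rho>"
  have psd: "pos_semidef ?\<sigma>"
    using st by (simp add: quantum_state_def pos_semidef_local_conj)
  have inv: "local_conj S' T' ?\<sigma> = \<rho>"
    by (rule local_conj_inverse[OF S'(2) T'(2)])
  have tr1: "trace \<rho> = 1"
    using st by (simp add: quantum_state_def)
  have "?\<sigma> \<noteq> 0"
  proof
    assume "?\<sigma> = 0"
    then have "\<rho> = 0"
      using inv by (simp add: local_conj_def)
    then show False using tr1 by (simp add: trace_def)
  qed
  then have q: "quantum_state (normalize_op ?\<sigma>)" and tr: "trace ?\<sigma> \<noteq> 0"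
    using quantum_state_normalize_op[OF psd] pos_semidef_trace_0[OF psd] by auto
  \<comment> \<open>The return trip starts from the normalized state, so it yields
    \<open>\<rho>\<close> only up to a factor, which the second normalization removes.\<close>
  have eq: "local_conj S' T' (normalize_op ?\<sigma>) = mat (1 / trace ?\<sigma>) ** \<rho>"
    by (simp add: normalize_op_eq local_conj_scale inv)
  have "E (normalize_op (local_conj S' T' (normalize_op ?\<sigma>))) \<le> E (normalize_op ?\<sigma>)"
    using C q tr by (intro mono) (simp_all add: eq trace_mat_mult tr1)
  then have "E \<rho> \<le> E (normalize_op ?\<sigma>)"
    using tr by (simp add: eq normalize_op_scale tr1)
  moreover have "E (normalize_op ?\<sigma>) \<le> E \<rho>"
    by (rule mono[OF C(1) st tr])
  ultimately show ?thesis by simp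
qed

section \<open>Partial contractions and the leading Schmidt pair\<close>

definition contract_left :: "complex ^ 'm::finite \<Rightarrow> complex ^ ('m \<times> 'n::finite) \<Rightarrow> complex ^ 'n" where
  "contract_left x \<psi> = (\<chi> j. \<Sum>i\<in>UNIV. cnj (x $ i) * \<psi> $ (i, j))"

text \<open>Both contractions are partial inner products, antilinear in the vector that is
  contracted away. The range of this one over all \<open>y\<close> will measure the Schmidt
  rank.\<close>

definition contract_right :: "complex ^ 'n::finite \<Rightarrow> complex ^ ('m::finite \<times> 'n) \<Rightarrow> complex ^ 'm" where
  "contract_right y \<psi> = (\<chi> i. \<Sum>j\<in>UNIV. cnj (y $ j) * \<psi> $ (i, j))"

lemma contract_left_tensor_vec: "contract_left x (tensor_vec a b) = cinner x a *s b"
  by (simp add: contract_left_def tensor_vec_def cinner_def vec_eq_iff sum_distrib_right sum_distrib_left mult_ac)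

lemma contract_right_tensor_vec: "contract_right y (tensor_vec a b) = cinner y b *s a"
  by (simp add: contract_right_def tensor_vec_def cinner_def vec_eq_iff sum_distrib_right sum_distrib_left mult_ac)

lemma contract_left_diff: "contract_left x (\<psi> - \<phi>) = contract_left x \<psi> - contract_left x \<phi>"
  by (simp add: contract_left_def vec_eq_iff algebra_simps sum_subtractf)

lemma contract_right_diff: "contract_right x (\<psi> - \<phi>) = contract_right x \<psi> - contract_right x \<phi>"
  by (simp add: contract_right_def vec_eq_iff algebra_simps sum_subtractf)

lemma contract_left_scaleR: "contract_left x (c *\<^sub>R \<psi>) = c *\<^sub>R contract_left x \<psi>"
  by (simp add: contract_left_def vec_eq_iff scaleR_sum_right)

lemma contract_right_scaleR: "contract_right x (c *\<^sub>R \<psi>) = c *\<^sub>R contract_right x \<psi>"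
  by (simp add: contract_right_def vec_eq_iff scaleR_sum_right)

lemma contract_right_sum: "contract_right y (sum f I) = (\<Sum>i\<in>I. contract_right y (f i))"
  unfolding contract_right_def vec_eq_iff sum_component vec_lambda_beta sum_distrib_left
  by (intro allI sum.swap)

text \<open>Links the Hermitian identities to the maximisation below, which is carried out in the
  real inner product.\<close>

lemma inner_eq_Re_cinner: "inner x y = Re (cinner x y)"
  by (simp add: inner_vec_def cinner_def inner_complex_def)

lemma cinner_contract_left: "cinner (tensor_vec a b) \<psi> = cinner b (contract_left a \<psi>)"
  unfolding cinner_def tensor_vec_def contract_left_def sum_prod_UNIV
  by (subst sum.swap) (simp add: sum_distrib_left mult_ac)

lemma cinner_contract_right: "cinner (tensor_vec a b) \<psi> = cinner a (contract_right b \<psi>)"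
  unfolding cinner_def tensor_vec_def contract_right_def sum_prod_UNIV
  by (simp add: sum_distrib_left mult_ac)

lemma scaleR_eq_scale: "c *\<^sub>R (x :: complex ^ 'k) = complex_of_real c *s x"
  by (simp add: vec_eq_iff scaleR_conv_of_real[where 'a=complex])

text \<open>The equality case of Cauchy-Schwarz: comparing \<open>a\<close> with the normalized
  \<open>v\<close> gives \<open>norm v \<le> inner a v\<close>, while the component of
  \<open>v\<close> orthogonal to \<open>a\<close> has squared norm
  \<open>norm v ^ 2 - inner a v ^ 2\<close>.\<close>

lemma inner_maximal_imp_parallel:
  fixes a v :: "'a::real_inner"
  assumes max: "\<And>x. norm x = 1 \<Longrightarrow> inner x v \<le> inner a v" and a: "norm a = 1"
  shows "v = inner a v *\<^sub>R a"
proof (cases "v = 0")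
  case False
  have "norm v \<le> inner a v"
    using max[of "v /\<^sub>R norm v"] False by (simp add: dot_square_norm power2_eq_square flip: mult.assoc)
  then have le: "norm v ^ 2 \<le> inner a v ^ 2" by (simp add: power_mono)
  have "inner (v - inner a v *\<^sub>R a) (v - inner a v *\<^sub>R a) = norm v ^ 2 - inner a v ^ 2"
    using a unfolding norm_eq_1 power2_norm_eq_inner
    by (simp add: inner_diff_left inner_diff_right inner_commute[of v a] power2_eq_square)
  also have "\<dots> \<le> 0" using le by simp
  finally have "v - inner a v *\<^sub>R a = 0"
    by (metis inner_eq_zero_iff inner_ge_zero order_antisym)
  then show ?thesis by simp
qed simp

text \<open>The pair maximises the real part of the overlap with \<open>\<psi>\<close> over a
  compact product of unit spheres, and \<open>l\<close> is the maximum. This is a variational form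
  of the largest singular value.\<close>

lemma leading_schmidt_pair:
  fixes \<psi> :: "complex ^ ('m::finite \<times> 'n::finite)"
  assumes "\<psi> \<noteq> 0"
  obtains l a b where "l > 0" "norm a = 1" "norm b = 1"
    "contract_left a \<psi> = l *\<^sub>R b" "contract_right b \<psi> = l *\<^sub>R a"
proof -
  let ?g = "\<lambda>p. inner (tensor_vec (fst p) (snd p)) \<psi>"
  let ?K = "sphere 0 1 \<times> sphere 0 1 :: ((complex ^ 'm) \<times> (complex ^ 'n)) set"
  obtain i j where ij: "\<psi> $ (i, j) \<noteq> 0"
    using assms by (auto simp: vec_eq_iff)
  \<comment> \<open>The phase \<open>u\<close> makes the overlap with a product of basis vectors positive.\<close>
  define u where "u = sgn (\<psi> $ (i, j))"
  have u: "(axis i u, axis j 1) \<in> ?K"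
    using ij by (simp add: u_def norm_eq_1[of "axis _ _"] inner_axis_axis norm_sgn flip: norm_eq_1)
  have cont: "continuous_on ?K ?g"
    unfolding tensor_vec_def inner_vec_def by (intro continuous_intros)
  have "compact ?K" by (intro compact_Times compact_sphere)
  then obtain p where "p \<in> ?K" and max: "\<And>q. q \<in> ?K \<Longrightarrow> ?g q \<le> ?g p"
    using continuous_attains_sup[OF _ _ cont] u by blast
  then obtain a b where ab: "p = (a, b)" "norm a = 1" "norm b = 1" by auto
  define l where "l = inner (tensor_vec a b) \<psi>"
  have "tensor_vec (axis i u) (axis j 1) = axis (i, j) u"
    by (auto simp: tensor_vec_def axis_def vec_eq_iff)
  then have "inner u (\<psi> $ (i, j)) \<le> l"
    using max[OF u] by (simp add: ab l_def inner_axis inner_axis')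
  moreover have "inner u (\<psi> $ (i, j)) > 0"
    using ij by (simp add: u_def sgn_div_norm dot_square_norm)
  ultimately have "l > 0" by simp
  have L: "inner (tensor_vec x y) \<psi> = inner y (contract_left x \<psi>)" for x y
    by (simp add: inner_eq_Re_cinner cinner_contract_left)
  have R: "inner (tensor_vec x y) \<psi> = inner x (contract_right y \<psi>)" for x y
    by (simp add: inner_eq_Re_cinner cinner_contract_right)
  \<comment> \<open>With one factor held fixed, the other maximises a real linear functional on its
    unit sphere, so it is parallel to the vector representing that functional.\<close>
  have "contract_left a \<psi> = inner b (contract_left a \<psi>) *\<^sub>R b"
    using max[of "(a, _)"] ab by (intro inner_maximal_imp_parallel) (simp_all add: L)
  moreover have "contract_right b \<psi> = inner a (contract_right b \<psi>) *\<^sub>R a"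
    using max[of "(_, b)"] ab by (intro inner_maximal_imp_parallel) (simp_all add: R)
  ultimately show thesis
    using that[OF \<open>l > 0\<close> ab(2,3)] L R l_def by metis
qed

section \<open>Orthogonal families\<close>

lemma orthogonal_independent:
  fixes g :: "nat \<Rightarrow> complex ^ 'k"
  assumes orth: "\<And>i j. i < r \<Longrightarrow> j < r \<Longrightarrow> cinner (g i) (g j) = 0 \<longleftrightarrow> i \<noteq> j"
  shows "inj_on g {..<r}" "vec.independent (g ` {..<r})"
proof -
  \<comment> \<open>The equivalence in \<open>orth\<close> also makes every
    \<open>cinner (g i) (g i)\<close> nonzero, so vectors with different indices differ.\<close>
  show inj: "inj_on g {..<r}"
    using orth by (intro inj_onI) (metis lessThan_iff)
  show "vec.independent (g ` {..<r})"
  proof (rule vec.independent_if_scalars_zero)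
    fix f x assume sum: "(\<Sum>x\<in>g ` {..<r}. f x *s x) = 0" and "x \<in> g ` {..<r}"
    then obtain i where i: "i < r" "x = g i" by auto
    have "0 = cinner (g i) (\<Sum>j<r. f (g j) *s g j)"
      using sum by (simp add: sum.reindex[OF inj] cinner_def)
    also have "\<dots> = (\<Sum>j<r. if j = i then f (g i) * cinner (g i) (g i) else 0)"
      unfolding cinner_sum_right cinner_scale_right using i orth by (intro sum.cong) auto
    also have "\<dots> = f (g i) * cinner (g i) (g i)"
      using i by simp
    finally show "f x = 0" using i orth[of i i] by auto
  qed simp
qed

lemma orthonormal_family_independent:
  assumes "orthonormal_family r e"
  shows "inj_on e {..<r}" "vec.independent (e ` {..<r})"
  using assms by (auto simp: orthonormal_family_def intro!: orthogonal_independent)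

text \<open>Bounds the number of vectors that the greedy construction can split off.\<close>

lemma orthonormal_family_bound:
  fixes e :: "nat \<Rightarrow> complex ^ 'k"
  assumes "orthonormal_family r e"
  shows "r \<le> vec.dim (UNIV :: (complex ^ 'k) set)"
  using vec.independent_card_le_dim[OF subset_UNIV orthonormal_family_independent(2)[OF assms]]
    orthonormal_family_independent(1)[OF assms]
  by (simp add: card_image)

lemma orthonormal_family_extend:
  assumes "orthonormal_family r e" "norm a = 1" "\<And>i. i < r \<Longrightarrow> cinner (e i) a = 0"
  shows "orthonormal_family (Suc r) (e(r := a))"
proof -
  have "cinner a (e i) = 0" if "i < r" for i
    using assms(3)[OF that] by (metis cnj_cinner complex_cnj_zero)
  then show ?thesis
    using assms by (auto simp: orthonormal_family_def less_Suc_eq cinner_self)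
qed

section \<open>Existence of the decomposition and uniqueness of its length\<close>

text \<open>Among the partial decompositions, one of maximal length has remainder zero: otherwise
  the leading pair of the remainder would extend it.\<close>

lemma schmidt_decomposition_exists:
  fixes \<psi> :: "complex ^ ('m::finite \<times> 'n::finite)"
  shows "\<exists>r l e f. schmidt_decomposition \<psi> r l e f"
proof -
  \<comment> \<open>The remainder \<open>\<phi>\<close> is orthogonal to the vectors already split off on both sides.\<close>
  define P where "P r l e f \<phi> \<longleftrightarrow> schmidt_decomposition (\<psi> - \<phi>) r l e f \<and>
      (\<forall>i<r. contract_left (e i) \<phi> = 0 \<and> contract_right (f i) \<phi> = 0)" for r l e f \<phi>
  define Q where "Q r \<longleftrightarrow> (\<exists>l e f \<phi>. P r l e f \<phi>)" for r
  have "P 0 l e f \<psi>" for l e f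
    by (simp add: P_def schmidt_decomposition_def orthonormal_family_def)
  then have "Q 0" unfolding Q_def by blast
  moreover have "\<forall>r. Q r \<longrightarrow> r \<le> vec.dim (UNIV :: (complex ^ 'm) set)"
    unfolding Q_def P_def schmidt_decomposition_def using orthonormal_family_bound by blast
  ultimately obtain r where "Q r" and rmax: "\<And>r'. Q r' \<Longrightarrow> r' \<le> r"
    using ex_has_greatest_nat[of Q 0 "\<lambda>r. r"] by (metis less_Suc_eq_le)
  then obtain l e f \<phi> where P: "P r l e f \<phi>" by (auto simp: Q_def)
  have "\<phi> = 0"
  proof (rule ccontr)
    assume "\<phi> \<noteq> 0"
    then obtain k a b where k: "k > 0" "norm a = 1" "norm b = 1"
      and la: "contract_left a \<phi> = k *\<^sub>R b" and rb: "contract_right b \<phi> = k *\<^sub>R a"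
      by (rule leading_schmidt_pair)
    \<comment> \<open>Up to the factor \<open>k\<close>, this is the overlap of the remainder with
      \<open>tensor_vec (e i) b\<close>. Contracting \<open>e i\<close> first shows that it
      vanishes. The argument for \<open>fb\<close> is symmetric.\<close>
    have ea: "cinner (e i) a = 0" if "i < r" for i
    proof -
      have "cinner (e i) (contract_right b \<phi>) = cinner b (contract_left (e i) \<phi>)"
        by (metis cinner_contract_left cinner_contract_right)
      also have "\<dots> = 0" using P that by (simp add: P_def cinner_def)
      finally show ?thesis using k by (simp add: rb scaleR_eq_scale cinner_scale_right)
    qed
    have fb: "cinner (f i) b = 0" if "i < r" for i
    proof -
      have "cinner (f i) (contract_left a \<phi>) = cinner a (contract_right (f i) \<phi>)"
        by (metis cinner_contract_left cinner_contract_right)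
      also have "\<dots> = 0" using P that by (simp add: P_def cinner_def)
      finally show ?thesis using k by (simp add: la scaleR_eq_scale cinner_scale_right)
    qed
    define \<phi>' where "\<phi>' = \<phi> - k *\<^sub>R tensor_vec a b"
    \<comment> \<open>For the old indices the subtracted product contributes nothing, by
      \<open>ea\<close> and \<open>fb\<close>; for the new one it cancels exactly the contraction
      given by \<open>la\<close> and \<open>rb\<close>.\<close>
    have "contract_left ((e(r := a)) i) \<phi>' = 0 \<and> contract_right ((f(r := b)) i) \<phi>' = 0" if "i < Suc r" for i
      using P that ea fb k
      by (auto simp: P_def \<phi>'_def less_Suc_eq contract_left_diff contract_right_diff
          contract_left_scaleR contract_right_scaleR contract_left_tensor_vec
          contract_right_tensor_vec la rb cinner_self)
    moreover have "schmidt_decomposition (\<psi> - \<phi>') (Suc r) (l(r := k)) (e(r := a)) (f(r := b))"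
      using P k ea fb
      by (auto simp: P_def schmidt_decomposition_def \<phi>'_def less_Suc_eq algebra_simps
          intro!: orthonormal_family_extend)
    ultimately have "P (Suc r) (l(r := k)) (e(r := a)) (f(r := b)) \<phi>'"
      unfolding P_def by blast
    then have "Q (Suc r)" unfolding Q_def by blast
    then show False using rmax by fastforce
  qed
  then show ?thesis using P by (auto simp: P_def)
qed

text \<open>The vectors \<open>e i\<close> form a basis of the range. As the range depends on
  \<open>\<psi>\<close> alone, all decompositions of \<open>\<psi>\<close> have the same
  length.\<close>

lemma schmidt_decomposition_rank_eq_dim:
  assumes "schmidt_decomposition \<psi> r l e f"
  shows "vec.dim (range (\<lambda>y. contract_right y \<psi>)) = r"
proof (rule vec.dim_unique)
  have e: "orthonormal_family r e" and f: "orthonormal_family r f" and l: "\<And>i. i < r \<Longrightarrow> l i > 0"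
    and \<psi>: "\<psi> = (\<Sum>i<r. l i *\<^sub>R tensor_vec (e i) (f i))"
    using assms by (auto simp: schmidt_decomposition_def)
  have contr: "contract_right y \<psi> = (\<Sum>i<r. (l i * cinner y (f i)) *s e i)" for y
    by (simp add: \<psi> contract_right_sum contract_right_scaleR contract_right_tensor_vec)
      (simp add: scaleR_eq_scale)
  show "range (\<lambda>y. contract_right y \<psi>) \<subseteq> vec.span (e ` {..<r})"
    unfolding contr by (intro image_subsetI vec.span_sum vec.span_scale vec.span_base imageI)
  show "e ` {..<r} \<subseteq> range (\<lambda>y. contract_right y \<psi>)"
  proof safe
    fix i assume i: "i < r"
    \<comment> \<open>The preimage of \<open>e i\<close> is \<open>f i\<close> divided by its
      coefficient; this scalar is real, so antilinearity does not change it.\<close>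
    have "contract_right (complex_of_real (1 / l i) *s f i) \<psi> = (\<Sum>j<r. if j = i then e i else 0)"
      unfolding contr cinner_scale_left using i l[OF i] f
      by (intro sum.cong) (auto simp: orthonormal_family_def)
    also have "\<dots> = e i" using i by simp
    finally show "e i \<in> range (\<lambda>y. contract_right y \<psi>)" by (rule range_eqI[OF sym])
  qed
  show "vec.independent (e ` {..<r})" "card (e ` {..<r}) = r"
    using orthonormal_family_independent[OF e] by (auto simp: card_image)
qed

text \<open>Existence and uniqueness of the length justify the definite description in
  \<open>schmidt_rank\<close>.\<close>

lemma schmidt_rank_decomposition: "\<exists>l e f. schmidt_decomposition \<psi> (schmidt_rank \<psi>) l e f"
proof -
  have "\<exists>!r. \<exists>l e f. schmidt_decomposition \<psi> r l e f"
    using schmidt_decomposition_exists[of \<psi>] schmidt_decomposition_rank_eq_dim by metis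
  then show ?thesis unfolding schmidt_rank_def by (rule theI')
qed

section \<open>Local equivalence of vectors of equal Schmidt rank\<close>

text \<open>Nonzero multiples of orthonormal vectors stay independent, so the assignment extends to
  an injective linear map of the whole space, which is invertible in finite dimension.\<close>

lemma orthonormal_family_map:
  fixes e e' :: "nat \<Rightarrow> complex ^ 'k"
  assumes e: "orthonormal_family r e" and e': "orthonormal_family r e'"
    and c: "\<And>i. i < r \<Longrightarrow> c i \<noteq> 0"
  obtains S where "invertible S" "\<And>i. i < r \<Longrightarrow> S *v e i = c i *s e' i"
proof -
  note ind = orthonormal_family_independent[OF e]
  have "cinner (c i *s e' i) (c j *s e' j) = 0 \<longleftrightarrow> i \<noteq> j" if "i < r" "j < r" for i j
    using that e' c by (auto simp: orthonormal_family_def cinner_scale_left cinner_scale_right)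
  note ind' = orthogonal_independent[OF this]
  \<comment> \<open>The extension theorem takes a function on vectors, so the index is recovered
    from the vector, using that \<open>e\<close> is injective below \<open>r\<close>.\<close>
  define h where "h = (\<lambda>x. let i = the_inv_into {..<r} e x in c i *s e' i)"
  have h: "h (e i) = c i *s e' i" if "i < r" for i
    using that by (simp add: h_def the_inv_into_f_f[OF ind(1)])
  then have img: "h ` e ` {..<r} = (\<lambda>i. c i *s e' i) ` {..<r}"
    by (simp add: image_image)
  have "inj_on h (e ` {..<r})"
    by (rule inj_on_imageI) (use ind'(1) h in \<open>simp add: inj_on_def\<close>)
  then obtain g where lin: "Vector_Spaces.linear (*s) (*s) g" and inj: "inj g"
    and g: "\<And>i. i < r \<Longrightarrow> g (e i) = h (e i)"
    using vec.linear_independent_extend_inj[OF ind(2), of h] ind'(2) unfolding img by auto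
  have works: "(*v) (matrix g) = g"
    using matrix_works[OF lin] by blast
  show thesis
  proof (rule that)
    show "invertible (matrix g)"
      using inj by (simp add: invertible_left_inverse matrix_left_invertible_injective works)
    show "matrix g *v e i = c i *s e' i" if "i < r" for i
      using that by (simp add: works g h)
  qed
qed

lemma equal_schmidt_rank_local_equivalent:
  assumes "schmidt_rank \<psi> = schmidt_rank \<phi>"
  obtains S T where "invertible S" "invertible T" "tensor_op S T *v \<psi> = \<phi>"
proof -
  define r where "r = schmidt_rank \<psi>"
  obtain l e f where \<psi>: "schmidt_decomposition \<psi> r l e f"
    using schmidt_rank_decomposition r_def by metis
  obtain l' e' f' where \<phi>: "schmidt_decomposition \<phi> r l' e' f'"
    using schmidt_rank_decomposition r_def assms by metis
  have pos: "\<And>i. i < r \<Longrightarrow> 0 < l i \<and> 0 < l' i"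
    and e: "orthonormal_family r e" "orthonormal_family r e'"
    and f: "orthonormal_family r f" "orthonormal_family r f'"
    using \<psi> \<phi> by (auto simp: schmidt_decomposition_def)
  have c: "complex_of_real (l' i / l i) \<noteq> 0" if "i < r" for i
    using pos[OF that] by simp
  \<comment> \<open>The first factor carries the whole ratio of the coefficients; the second only
    moves the basis.\<close>
  obtain S where S: "invertible S" "\<And>i. i < r \<Longrightarrow> S *v e i = complex_of_real (l' i / l i) *s e' i"
    using orthonormal_family_map[OF e, of "\<lambda>i. complex_of_real (l' i / l i)"] c by blast
  obtain T where T: "invertible T" "\<And>i. i < r \<Longrightarrow> T *v f i = 1 *s f' i"
    using orthonormal_family_map[OF f, of "\<lambda>_. 1"] by auto
  have scale: "tensor_vec (x *s a) b = x *s tensor_vec a b" for x and a :: "complex ^ 'a" and b :: "complex ^ 'b"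
    by (simp add: tensor_vec_def vec_eq_iff)
  have "tensor_op S T *v \<psi> = (\<Sum>i<r. l i *\<^sub>R (tensor_op S T *v tensor_vec (e i) (f i)))"
    using \<psi> by (simp add: schmidt_decomposition_def vec.sum scaleR_eq_scale vec.scale)
  also have "\<dots> = (\<Sum>i<r. l' i *\<^sub>R tensor_vec (e' i) (f' i))"
  proof (rule sum.cong)
    fix i assume "i \<in> {..<r}"
    then have i: "i < r" by simp
    then show "l i *\<^sub>R (tensor_op S T *v tensor_vec (e i) (f i)) = l' i *\<^sub>R tensor_vec (e' i) (f' i)"
      using pos[OF i] by (simp add: tensor_op_tensor_vec S T scale scaleR_eq_scale)
  qed simp
  also have "\<dots> = \<phi>" using \<phi> by (simp add: schmidt_decomposition_def)
  finally show thesis using that S T by blast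
qed

theorem mainTheorem4:
  fixes E :: "complex ^ ('m::finite \<times> 'n::finite) ^ ('m \<times> 'n) \<Rightarrow> real"
    and C_X :: "('m, 'n) op_map set"
  assumes "sep_subclass C_X"
    and "entanglement_measure C_X E"
    and "C_LI \<subseteq> C_X"
  shows "universal_entanglement_measure C_X E \<and>
         (\<forall>\<psi> \<phi>. pure_state \<psi> \<and> pure_state \<phi> \<and> schmidt_rank \<psi> = schmidt_rank \<phi> \<longrightarrow>
                E (proj_op \<psi>) = E (proj_op \<phi>))"
proof (intro conjI allI impI)
  note invariant = entanglement_measure_LI_invariant[OF assms(2,3)]
  show "universal_entanglement_measure C_X E"
    using assms(2) invariant by (auto simp: universal_entanglement_measure_def C_LI_def)
  fix \<psi> \<phi> :: "complex ^ ('m \<times> 'n)"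
  assume "pure_state \<psi> \<and> pure_state \<phi> \<and> schmidt_rank \<psi> = schmidt_rank \<phi>"
  then have \<psi>: "quantum_state (proj_op \<psi>)" and \<phi>: "quantum_state (proj_op \<phi>)"
    and rank: "schmidt_rank \<psi> = schmidt_rank \<phi>"
    by (auto intro: quantum_state_proj_op)
  obtain S T where ST: "invertible S" "invertible T" "tensor_op S T *v \<psi> = \<phi>"
    using equal_schmidt_rank_local_equivalent[OF rank] .
  \<comment> \<open>The image vector is already a unit vector, so normalization changes nothing and
    invariance compares the two pure states directly.\<close>
  have "normalize_op (proj_op \<phi>) = proj_op \<phi>"
    using \<phi> by (simp add: normalize_op_def quantum_state_def vec_eq_iff)
  then show "E (proj_op \<psi>) = E (proj_op \<phi>)"
    using invariant[OF \<psi> ST(1,2)] by (simp add: local_conj_proj_op ST(3))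
qed

end
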